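(* For every torus link $\mathcal{L}$ there exists a complex algebraic plane curve $\mathcal{C}\subset(\mathbb{C}^* )^2$ such that $\mathcal{L}$ is realized as the union of the one-dimensional connected components of the set of critical values of the argument map restricted to $\mathcal{C}$; that is, this union, viewed as a subset of the real torus $S^1\times S^1$ regarded as an unknotted torus in $\mathbb{R}^3$, is a link equivalent to $\mathcal{L}$.
   Context: The argument map is $\mathrm{Arg}:(\mathbb{C}^* )^2\to S^1\times S^1$, $(z,w)\mapsto\left(\frac{z}{|z|},\frac{w}{|w|}\right)$. For a complex curve $\mathcal{C}\subset(\mathbb{C}^* )^2$ (the zero locus of a polynomial in two variables), a critical point of the restriction $\mathrm{Arg}|_{\mathcal{C}}$ is a point of $\mathcal{C}$ at which the real Jacobian matrix of $\mathrm{Arg}|_{\mathcal{C}}$ has rank less than $2$; a critical value is the image under $\mathrm{Arg}$ of a critical point. A link is a subset of $\mathbb{R}^3$ homeomorphic to a disjoint union of circles (a knot if there is one circle). A torus link (torus knot) is a link (knot) that lies on an unknotted 2-dimensional real torus embedded in $\mathbb{R}^3$. Every torus link is associated to a pair of integers $p,q$ (coprime exactly for torus knots), the number of its connected components being $\gcd(p,q)$: it consists of $\gcd(p,q)$ disjoint parallel simple closed curves on the torus which together wind $p$ times in the direction of one circle factor and $q$ times in the direction of the other. Links are considered up to equivalence (ambient isotopy in $\mathbb{R}^3$). *)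

theory Defs
  imports "HOL-Analysis.Analysis" "HOL-Computational_Algebra.Polynomial"
begin

section \<open>Plane curves and the argument map\<close>

definition complex_torus :: "(complex \<times> complex) set" where
  "complex_torus = {(z, w). z \<noteq> 0 \<and> w \<noteq> 0}"

definition arg_map :: "complex \<times> complex \<Rightarrow> complex \<times> complex" where
  "arg_map = (\<lambda>(z, w). (z / complex_of_real (cmod z), w / complex_of_real (cmod w)))"

(* A polynomial in two variables z, w is an element of C[z][w]. *)
definition eval2 :: "complex poly poly \<Rightarrow> complex \<Rightarrow> complex \<Rightarrow> complex" where
  "eval2 f z w = poly (poly f [:w:]) z"

definition plane_curve :: "(complex \<times> complex) set \<Rightarrow> bool" where
  "plane_curve C \<longleftrightarrow>
     (\<exists>f :: complex poly poly. (\<nexists>c. f = [:[:c:]:]) \<and>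
        C = {(z, w). (z, w) \<in> complex_torus \<and> eval2 f z w = 0})"

text \<open>Regular holomorphic local parametrisations of a plane curve. They exist exactly around the
  smooth points of the (reduced) curve.\<close>

definition curve_chart ::
  "(complex \<times> complex) set \<Rightarrow> complex set \<Rightarrow> (complex \<Rightarrow> complex \<times> complex) \<Rightarrow> bool" where
  "curve_chart C U \<phi> \<longleftrightarrow>
     open U \<and>
     (\<lambda>t. fst (\<phi> t)) holomorphic_on U \<and> (\<lambda>t. snd (\<phi> t)) holomorphic_on U \<and>
     (\<forall>t\<in>U. (deriv (\<lambda>t. fst (\<phi> t)) t, deriv (\<lambda>t. snd (\<phi> t)) t) \<noteq> (0, 0)) \<and>
     openin (top_of_set C) (\<phi> ` U) \<and>
     (\<exists>\<psi>. homeomorphism U (\<phi> ` U) \<phi> \<psi>)"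

text \<open>The real Jacobian of the restriction of the argument map to \<open>C\<close> at a smooth point is the
  real derivative of its expression in a local parametrisation; here \<open>D\<close> is a real-linear map from
  \<open>\<complex>\<close> to \<open>\<complex> \<times> \<complex>\<close> and \<open>dim\<close> is the dimension over the reals. The rank does not depend on the
  parametrisation. At singular points of \<open>C\<close> there is no Jacobian, so these are not critical points
  in this sense.\<close>

definition critical_points :: "(complex \<times> complex) set \<Rightarrow> (complex \<times> complex) set" where
  "critical_points C =
     {x. \<exists>U \<phi> t D. curve_chart C U \<phi> \<and> t \<in> U \<and> \<phi> t = x \<and>
          ((\<lambda>s. arg_map (\<phi> s)) has_derivative D) (at t) \<and> dim (range D) < 2}"

definition critical_values :: "(complex \<times> complex) set \<Rightarrow> (complex \<times> complex) set" where
  "critical_values C = arg_map ` critical_points C"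

definition one_dimensional :: "'a::topological_space set \<Rightarrow> bool" where
  "one_dimensional S \<longleftrightarrow> top_of_set S dim_le 1 \<and> \<not> top_of_set S dim_le 0"

definition one_dimensional_part :: "'a::topological_space set \<Rightarrow> 'a set" where
  "one_dimensional_part V = \<Union> {S \<in> components V. one_dimensional S}"

section \<open>Links\<close>

definition link :: "(real^3) set \<Rightarrow> bool" where
  "link L \<longleftrightarrow> (\<exists>n\<ge>1. L homeomorphic (real ` {..<n} \<times> sphere (0::complex) 1))"

definition ambient_isotopy :: "(real \<Rightarrow> real^3 \<Rightarrow> real^3) \<Rightarrow> bool" where
  "ambient_isotopy H \<longleftrightarrow>
     continuous_on ({0..1} \<times> UNIV) (\<lambda>(t, x). H t x) \<and>
     (\<forall>x. H 0 x = x) \<and>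
     (\<forall>t\<in>{0..1}. \<exists>G. homeomorphism UNIV UNIV (H t) G)"

definition link_equivalent :: "(real^3) set \<Rightarrow> (real^3) set \<Rightarrow> bool" where
  "link_equivalent K L \<longleftrightarrow> (\<exists>H. ambient_isotopy H \<and> H 1 ` K = L)"

section \<open>Torus links\<close>

definition real_torus :: "(complex \<times> complex) set" where
  "real_torus = sphere 0 1 \<times> sphere 0 1"

text \<open>The standard (rotationally symmetric) unknotted embedding of \<open>real_torus\<close>.\<close>

definition std_torus :: "complex \<times> complex \<Rightarrow> real^3" where
  "std_torus = (\<lambda>(z, w). vector [(2 + Re w) * Re z, (2 + Re w) * Im z, Im w])"

text \<open>An embedding, rather than just its image, is called unknotted here: this records which
  directions on the torus are the two circle factors.\<close>

definition unknotted_torus :: "(complex \<times> complex \<Rightarrow> real^3) \<Rightarrow> bool" where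
  "unknotted_torus e \<longleftrightarrow>
     (\<exists>H. ambient_isotopy H \<and> (\<forall>x\<in>real_torus. e x = H 1 (std_torus x)))"

text \<open>A simple closed curve for coprime \<open>p\<close>, \<open>q\<close>; curves with the same \<open>p\<close>, \<open>q\<close> are translates of
  each other, i.e. parallel.\<close>

definition winding_curve :: "int \<Rightarrow> int \<Rightarrow> complex \<Rightarrow> complex \<Rightarrow> (complex \<times> complex) set" where
  "winding_curve p q a b =
     (\<lambda>t. (a * cis (2 * pi * of_int p * t), b * cis (2 * pi * of_int q * t))) ` {0..1}"

text \<open>The \<open>gcd p q\<close> curves each wind \<open>p div gcd p q\<close> and \<open>q div gcd p q\<close> times, hence together
  \<open>p\<close> and \<open>q\<close> times. Replacing \<open>e\<close> by its composition with a self-homeomorphism of the torus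
  isotopic to the identity shows that taking linear curves in the parameter torus is no restriction.\<close>

definition parallel_curves :: "int \<Rightarrow> int \<Rightarrow> (complex \<times> complex) set \<Rightarrow> bool" where
  "parallel_curves p q K \<longleftrightarrow>
     (\<exists>a b :: nat \<Rightarrow> complex.
        (\<forall>j < nat (gcd p q). (a j, b j) \<in> real_torus) \<and>
        (\<forall>i < nat (gcd p q). \<forall>j < nat (gcd p q). i \<noteq> j \<longrightarrow>
           winding_curve (p div gcd p q) (q div gcd p q) (a i) (b i) \<inter>
           winding_curve (p div gcd p q) (q div gcd p q) (a j) (b j) = {}) \<and>
        K = (\<Union>j < nat (gcd p q). winding_curve (p div gcd p q) (q div gcd p q) (a j) (b j)))"

text \<open>The case \<open>p = q = 0\<close> (no curves at all) is excluded by \<open>link\<close>.\<close>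

definition torus_link :: "(real^3) set \<Rightarrow> bool" where
  "torus_link L \<longleftrightarrow> link L \<and>
     (\<exists>e p q K. unknotted_torus e \<and> parallel_curves p q K \<and> L = e ` K)"

end

theory Submission
  imports Defs
begin

text \<open>For coprime \<open>p\<close>, \<open>q\<close> the curve \<open>z^q w^(-p) = c\<close> with \<open>|c| = 1\<close> is locally parametrised by
  \<open>t \<mapsto> (z0 exp (p t), w0 exp (q t))\<close>, and the argument map sees only \<open>Im t\<close>. So every point of it is
  critical, and its set of critical values is the coset \<open>u^q v^(-p) = c\<close> of a one-parameter subgroup of
  the real torus, which is a winding curve of type \<open>(p, q)\<close>. Hence parallel winding curves through
  \<open>(a j, b j)\<close> are exactly the critical values of the union of the disjoint curves
  \<open>z^q w^(-p) = a j^q b j^(-p)\<close>.\<close>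

section \<open>Winding curves as level sets of a character of the torus\<close>

definition torus_char :: "int \<Rightarrow> int \<Rightarrow> complex \<times> complex \<Rightarrow> complex" where
  "torus_char p q = (\<lambda>(z, w). z powi q * w powi (- p))"

text \<open>In the \<open>p\<close>-th power \<open>u^(r p) v^(s p)\<close> of
  \<open>u^r v^s\<close>, the relation trades \<open>v^(s p)\<close> for \<open>u^(s q)\<close>, so
  the exponent of \<open>u\<close> becomes the Bezout sum 1; the \<open>q\<close>-th power is
  symmetric. Thus solutions of \<open>u^q = v^p\<close> are parametrised by a single
  \<zeta>.\<close>

lemma power_int_common_root:
  fixes u v :: complex
  assumes bez: "r * p + s * q = 1" and nz: "u \<noteq> 0" "v \<noteq> 0" and eq: "u powi q = v powi p"
  shows "(u powi r * v powi s) powi p = u" "(u powi r * v powi s) powi q = v"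
proof -
  have "v powi (s * p) = (v powi p) powi s"
    by (metis mult.commute power_int_mult)
  also have "\<dots> = u powi (s * q)"
    by (metis eq mult.commute power_int_mult)
  finally have "(u powi r * v powi s) powi p = u powi (r * p + s * q)"
    using nz by (simp add: power_int_mult_distrib power_int_add flip: power_int_mult)
  then show "(u powi r * v powi s) powi p = u"
    by (simp add: bez)
  have "u powi (r * q) = (u powi q) powi r"
    by (metis mult.commute power_int_mult)
  also have "\<dots> = v powi (r * p)"
    by (metis eq mult.commute power_int_mult)
  finally have "(u powi r * v powi s) powi q = v powi (r * p + s * q)"
    using nz by (simp add: power_int_mult_distrib power_int_add flip: power_int_mult)
  then show "(u powi r * v powi s) powi q = v"
    by (simp add: bez)
qed

lemma torus_char_eq_iff:
  assumes "z \<noteq> 0" "w \<noteq> 0" "a \<noteq> 0" "b \<noteq> 0"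
  shows "torus_char p q (z, w) = torus_char p q (a, b) \<longleftrightarrow> (z / a) powi q = (w / b) powi p"
  using assms by (auto simp: torus_char_def power_int_minus power_int_divide_distrib divide_simps)

text \<open>Taking the parameter on the circle glues the two ends of the interval and turns the
  curve into a pair of integer powers, as the level set and injectivity arguments require.\<close>

lemma winding_curve_eq_image:
  "winding_curve p q a b = (\<lambda>\<zeta>. (a * \<zeta> powi p, b * \<zeta> powi q)) ` sphere 0 1"
proof -
  have "sphere 0 1 = (\<lambda>t. cis (2 * pi * t)) ` {0..1}"
  proof (intro equalityI subsetI)
    fix z :: complex assume "z \<in> sphere 0 1"
    then have "z = cis (Arg2pi z)"
      by (metis Arg2pi_eq cis_conv_exp mem_sphere_0 mult_1 of_real_1)
    moreover have "Arg2pi z / (2 * pi) \<in> {0..1}"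
      using Arg2pi_ge_0[of z] Arg2pi_lt_2pi[of z] by (simp add: divide_simps)
    ultimately show "z \<in> (\<lambda>t. cis (2 * pi * t)) ` {0..1}"
      by (intro image_eqI[of _ _ "Arg2pi z / (2 * pi)"]) auto
  qed auto
  then show ?thesis
    by (simp add: winding_curve_def image_image cis_power_int mult_ac)
qed

text \<open>Along the curve the powers of \<zeta> cancel in the character. Conversely, dividing a
  point of the level set by \<open>(a, b)\<close> gives \<open>u^q = v^p\<close>; the common root of
  \<open>u\<close> and \<open>v\<close> is the parameter, of modulus 1 because theirs is.
  Coprimality keeps the level set to a single curve.\<close>

lemma winding_curve_eq_level_set:
  assumes "coprime p q" and ab: "(a, b) \<in> real_torus"
  shows "winding_curve p q a b = {x \<in> real_torus. torus_char p q x = torus_char p q (a, b)}"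
proof (intro equalityI subsetI)
  fix x assume "x \<in> winding_curve p q a b"
  then obtain \<zeta> where "cmod \<zeta> = 1" "x = (a * \<zeta> powi p, b * \<zeta> powi q)"
    by (auto simp: winding_curve_eq_image)
  moreover from this have "\<zeta> \<noteq> 0" "a \<noteq> 0" "b \<noteq> 0"
    using ab by (auto simp: real_torus_def)
  ultimately show "x \<in> {x \<in> real_torus. torus_char p q x = torus_char p q (a, b)}"
    using ab by (auto simp: real_torus_def torus_char_eq_iff norm_mult norm_power_int
        mult.commute simp flip: power_int_mult)
next
  fix x assume x: "x \<in> {x \<in> real_torus. torus_char p q x = torus_char p q (a, b)}"
  obtain r s where bez: "r * p + s * q = 1"
    using bezout_int[of p q] assms(1) by (auto simp: coprime_iff_gcd_eq_1)
  define u v where "u = fst x / a" and "v = snd x / b"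
  have nz: "a \<noteq> 0" "b \<noteq> 0" "u \<noteq> 0" "v \<noteq> 0" and n1: "cmod u = 1" "cmod v = 1"
    using x ab by (auto simp: real_torus_def u_def v_def norm_divide)
  have "u powi q = v powi p"
    using x nz torus_char_eq_iff[of "fst x" "snd x" a b p q] by (simp add: u_def v_def)
  note root = power_int_common_root[OF bez nz(3,4) this]
  have "x = (\<lambda>\<zeta>. (a * \<zeta> powi p, b * \<zeta> powi q)) (u powi r * v powi s)"
    unfolding root using nz by (simp add: u_def v_def)
  then show "x \<in> winding_curve p q a b"
    unfolding winding_curve_eq_image using n1
    by (intro image_eqI[where x = "u powi r * v powi s"]) (auto simp: norm_mult norm_power_int)
qed

text \<open>A continuous injection of a compact space into a Hausdorff space is a homeomorphism onto
  its image; the Bezout monomial \<open>(x / a)^r (y / b)^s\<close> recovers \<zeta> and so gives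
  injectivity.\<close>

lemma winding_curve_homeomorphic_circle:
  assumes "coprime p q" and ab: "(a, b) \<in> real_torus"
  shows "winding_curve p q a b homeomorphic sphere (0::complex) 1"
proof -
  obtain r s where bez: "r * p + s * q = 1"
    using bezout_int[of p q] assms(1) by (auto simp: coprime_iff_gcd_eq_1)
  have nz: "a \<noteq> 0" "b \<noteq> 0" using ab by (auto simp: real_torus_def)
  define f where "f = (\<lambda>\<zeta>. (a * \<zeta> powi p, b * \<zeta> powi q))"
  have cont: "continuous_on (sphere 0 1) f"
    unfolding f_def by (intro continuous_intros) auto
  have "inj_on f (sphere 0 1)"
  proof (rule inj_on_inverseI)
    fix \<zeta> :: complex assume "\<zeta> \<in> sphere 0 1"
    then have "\<zeta> \<noteq> 0" by auto
    then have "\<zeta> powi (r * p + s * q) = (\<zeta> powi p) powi r * (\<zeta> powi q) powi s"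
      by (simp add: power_int_add mult.commute flip: power_int_mult)
    then show "(\<lambda>x. (fst x / a) powi r * (snd x / b) powi s) (f \<zeta>) = \<zeta>"
      using nz by (simp add: f_def bez)
  qed
  moreover have "f ` sphere 0 1 = winding_curve p q a b"
    by (simp add: f_def winding_curve_eq_image)
  ultimately have "sphere (0::complex) 1 homeomorphic winding_curve p q a b"
    using cont homeomorphic_compact[OF compact_sphere] by blast
  then show ?thesis
    by (rule homeomorphic_sym[THEN iffD1])
qed

section \<open>Dimension of the circle and components of a union of circles\<close>

text \<open>Rotation by \<open>cnj a\<close> moves the centre to 1. Expanding |1 - w|^2 = r^2 with
  |w| = 1 gives 2 - 2 Re w = r^2, so Re w is the constant \<open>k\<close> and Im w has at most two
  values.\<close>

lemma finite_circle_Int_sphere: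
  assumes "cmod a = 1"
  shows "finite (sphere 0 1 \<inter> sphere a r)"
proof -
  define k where "k = (2 - r\<^sup>2) / 2"
  have "z \<in> (*) a ` {Complex k (sqrt (1 - k\<^sup>2)), Complex k (- sqrt (1 - k\<^sup>2))}"
    if z: "cmod z = 1" "cmod (a - z) = r" for z
  proof -
    have a: "a * cnj a = 1"
      using assms by (simp add: complex_norm_square[symmetric])
    define w where "w = z * cnj a"
    have zw: "z = a * w"
      using a by (simp add: w_def mult_ac)
    have "cmod w = 1"
      using z(1) assms by (simp add: w_def norm_mult)
    then have w: "(Re w)\<^sup>2 + (Im w)\<^sup>2 = 1"
      by (metis cmod_power2 one_power2)
    have "a - z = a * (1 - w)"
      by (simp add: zw algebra_simps)
    then have "cmod (1 - w) = r"
      using z(2) assms by (simp add: norm_mult)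
    then have "(1 - Re w)\<^sup>2 + (Im w)\<^sup>2 = r\<^sup>2"
      using cmod_power2[of "1 - w"] by simp
    then have k: "Re w = k"
      using w by (simp add: k_def power2_eq_square algebra_simps)
    then have "(Im w)\<^sup>2 = 1 - k\<^sup>2" using w by simp
    then have "Im w = sqrt (1 - k\<^sup>2) \<or> Im w = - sqrt (1 - k\<^sup>2)"
      by (metis real_sqrt_abs abs_if minus_minus)
    then show ?thesis using k zw by (auto simp: complex_eq_iff)
  qed
  then have "sphere 0 1 \<inter> sphere a r \<subseteq> (*) a ` {Complex k (sqrt (1 - k\<^sup>2)), Complex k (- sqrt (1 - k\<^sup>2))}"
    by (metis (no_types, lifting) IntE dist_norm mem_sphere mem_sphere_0 subsetI)
  then show ?thesis by (rule finite_subset) auto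
qed

lemma finite_imp_dim_le_0:
  fixes F :: "'a::t1_space set"
  assumes "finite F"
  shows "top_of_set F dim_le 0"
proof -
  have "openin (top_of_set F) {x}" if "x \<in> F" for x
  proof -
    have "{x} = F \<inter> - (F - {x})" using that by auto
    then show ?thesis
      using assms by (metis finite_Diff finite_imp_closed open_Compl openin_open)
  qed
  then have "discrete_topology F = top_of_set F"
    by (simp add: discrete_topology_unique)
  then show ?thesis by (metis dimension_le_discrete_topology)
qed

text \<open>\<open>dim_le\<close> is the small inductive dimension. Small balls meet the circle in
  neighbourhoods with finite, hence zero-dimensional, frontier. Dimension 0 would give a clopen
  neighbourhood of 1 that misses -1, against connectedness.\<close>

lemma one_dimensional_circle: "one_dimensional (sphere (0::complex) 1)"
proof -
  let ?S = "sphere (0::complex) 1"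
  have "top_of_set ?S dim_le 1"
  proof (subst dimension_le_eq_subtopology, intro conjI allI impI)
    fix V and a :: complex assume "openin euclidean V \<and> a \<in> V \<and> a \<in> ?S"
    then obtain e where e: "e > 0" "ball a e \<subseteq> V" and a: "cmod a = 1"
      by (auto simp: open_contains_ball)
    have "top_of_set ?S frontier_of (?S \<inter> ball a e) \<subseteq> ?S \<inter> sphere a e"
    proof -
      have "?S \<inter> (top_of_set ?S frontier_of ball a e) \<subseteq> frontier (ball a e)"
        using frontier_of_subtopology_subset[of ?S euclidean "ball a e"] by simp
      moreover have "top_of_set ?S frontier_of (?S \<inter> ball a e) \<subseteq> ?S"
        using frontier_of_subset_topspace[of "top_of_set ?S"] by simp
      moreover have "top_of_set ?S frontier_of (?S \<inter> ball a e) = top_of_set ?S frontier_of ball a e"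
        by (metis frontier_of_restrict topspace_euclidean_subtopology)
      ultimately show ?thesis using e by auto
    qed
    then have "finite (top_of_set ?S frontier_of (?S \<inter> ball a e))"
      using finite_circle_Int_sphere[OF a] finite_subset by blast
    then show "\<exists>U. a \<in> U \<and> U \<subseteq> V \<and> openin euclidean U \<and>
        top_of_set (top_of_set ?S frontier_of (?S \<inter> U)) dim_le 1 - 1"
      using e by (intro exI[of _ "ball a e"]) (simp add: finite_imp_dim_le_0)
  qed auto
  moreover have "\<not> top_of_set ?S dim_le 0"
  proof
    assume "top_of_set ?S dim_le 0"
    then have base: "\<exists>U. closedin (top_of_set ?S) U \<and> openin (top_of_set ?S) U \<and> x \<in> U \<and> U \<subseteq> W"
      if "openin (top_of_set ?S) W" "x \<in> W" for W x
      using that open_neighbourhood_base_of[of "\<lambda>U. closedin (top_of_set ?S) U \<and> openin (top_of_set ?S) U"]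
      by (simp add: dimension_le_0_neighbourhood_base_of_clopen)
    have "openin (top_of_set ?S) (?S - {-1})"
      by (simp add: openin_diff)
    then obtain U where U: "closedin (top_of_set ?S) U" "openin (top_of_set ?S) U" "1 \<in> U" "U \<subseteq> ?S - {-1}"
      using base[of "?S - {-1}" 1] by auto
    moreover have "connected ?S" by (rule connected_sphere) simp
    ultimately have "U = {} \<or> U = ?S"
      by (auto simp: connected_clopen)
    moreover have "- 1 \<in> ?S" by simp
    ultimately show False using U by blast
  qed
  ultimately show ?thesis by (simp add: one_dimensional_def)
qed

lemma one_dimensional_homeomorphic:
  assumes "S homeomorphic T" "one_dimensional T"
  shows "one_dimensional S"
proof -
  obtain f g where "homeomorphism S T f g"
    using assms(1) by (auto simp: homeomorphic_def)
  then have "homeomorphic_maps (top_of_set S) (top_of_set T) f g"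
    by (force simp: Pi_iff homeomorphic_maps_def homeomorphism_def)
  then have "top_of_set S homeomorphic_space top_of_set T"
    by (auto simp: homeomorphic_space_def)
  from homeomorphic_space_dimension_le[OF this] show ?thesis
    using assms(2) by (simp add: one_dimensional_def)
qed

text \<open>The union of the other members is closed by finiteness, so a connected set containing
  \<open>S\<close> cannot also meet it. This makes each member a maximal connected set, and any
  component meets some member.\<close>

lemma components_Union_finite:
  assumes fin: "finite \<F>" and disj: "pairwise disjnt \<F>"
    and mem: "\<And>S. S \<in> \<F> \<Longrightarrow> closed S \<and> connected S \<and> S \<noteq> {}"
  shows "components (\<Union>\<F>) = \<F>"
proof -
  have comp: "S \<in> components (\<Union>\<F>)" if S: "S \<in> \<F>" for S
    unfolding in_components_maximal
  proof (intro conjI allI impI)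
    fix D assume D: "D \<noteq> {} \<and> S \<subseteq> D \<and> D \<subseteq> \<Union>\<F> \<and> connected D"
    have "closed (\<Union>(\<F> - {S}))" using fin mem by (intro closed_Union) auto
    moreover have "S \<inter> \<Union>(\<F> - {S}) = {}"
      using disj S by (auto simp: pairwise_def disjnt_def)
    ultimately have "D \<inter> \<Union>(\<F> - {S}) = {}"
      using connected_closedD[of D S "\<Union>(\<F> - {S})"] D mem[OF S] by blast
    then show "D = S" using D by blast
  qed (use S mem in auto)
  show ?thesis
  proof (intro equalityI subsetI)
    fix T assume T: "T \<in> components (\<Union>\<F>)"
    then obtain S where S: "S \<in> \<F>" "S \<inter> T \<noteq> {}"
      using in_components_nonempty[OF T] in_components_subset[OF T] by blast
    then show "T \<in> \<F>" using components_eq[OF comp T] by blast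
  qed (rule comp)
qed

section \<open>Polynomial equations for the level sets\<close>

text \<open>The equation \<open>z^q w^(-p) = c\<close> with denominators cleared:
  \<open>nat n\<close> and \<open>nat (- n)\<close> are the positive and negative parts of an
  exponent. The inner polynomial is in \<open>z\<close>, the outer one in \<open>w\<close>.\<close>

definition torus_char_poly :: "int \<Rightarrow> int \<Rightarrow> complex \<Rightarrow> complex poly poly" where
  "torus_char_poly p q c =
     monom (monom 1 (nat q)) (nat (- p)) - monom (monom c (nat (- q))) (nat p)"

lemma eval2_diff: "eval2 (f - g) z w = eval2 f z w - eval2 g z w"
  by (simp add: eval2_def)

lemma eval2_prod: "eval2 (\<Prod>i\<in>I. f i) z w = (\<Prod>i\<in>I. eval2 (f i) z w)"
  by (simp add: eval2_def poly_prod)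

lemma eval2_monom: "eval2 (monom (monom c m) n) z w = c * z ^ m * w ^ n"
  by (simp add: eval2_def poly_monom poly_power)

lemma power_int_split: "x \<noteq> 0 \<Longrightarrow> x powi n = x ^ nat n / x ^ nat (- n)" for x :: complex
  by (cases "n \<ge> 0") (auto simp: power_int_def power_inverse divide_inverse)

lemma eval2_torus_char_poly_eq_0:
  assumes "z \<noteq> 0" "w \<noteq> 0"
  shows "eval2 (torus_char_poly p q c) z w = 0 \<longleftrightarrow> torus_char p q (z, w) = c"
  using assms
  by (auto simp: torus_char_poly_def eval2_diff eval2_monom torus_char_def
      power_int_split[of z q] power_int_split[of w "- p"] divide_simps mult_ac)

text \<open>The product over \<open>A\<close> cuts out the union of the level sets. If it were
  constant, nonemptiness would make it zero, so the character would take values in \<open>A\<close>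
  everywhere; its moduli \<open>2^q\<close> at (2, 1) and \<open>2^(-p)\<close> at (1, 2) would both
  be 1, forcing p = q = 0.\<close>

lemma plane_curve_torus_char:
  assumes "finite A" and A: "\<And>c. c \<in> A \<Longrightarrow> cmod c = 1" and pq: "(p, q) \<noteq> (0, 0)"
    and ne: "{x \<in> complex_torus. torus_char p q x \<in> A} \<noteq> {}"
  shows "plane_curve {x \<in> complex_torus. torus_char p q x \<in> A}"
  unfolding plane_curve_def
proof (intro exI conjI)
  let ?f = "\<Prod>c\<in>A. torus_char_poly p q c"
  have zero: "eval2 ?f z w = 0 \<longleftrightarrow> torus_char p q (z, w) \<in> A" if "(z, w) \<in> complex_torus" for z w
    using that assms(1) by (auto simp: complex_torus_def eval2_prod eval2_torus_char_poly_eq_0)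
  then show "{x \<in> complex_torus. torus_char p q x \<in> A} = {(z, w). (z, w) \<in> complex_torus \<and> eval2 ?f z w = 0}"
    by auto
  show "\<nexists>k. ?f = [:[:k:]:]"
  proof
    assume "\<exists>k. ?f = [:[:k:]:]"
    then obtain k where k: "eval2 ?f z w = k" for z w
      by (auto simp: eval2_def)
    then have "k = 0"
      using ne zero by fastforce
    then have "torus_char p q (2, 1) \<in> A" "torus_char p q (1, 2) \<in> A"
      using zero[of 2 1] zero[of 1 2] k by (auto simp: complex_torus_def)
    from this[THEN A] have "(2::real) powi q = 1" "(2::real) powi (- p) = 1"
      by (auto simp: torus_char_def norm_mult norm_power_int)
    moreover have "n = 0" if "(2::real) powi n = 1" for n
      using that power_int_strict_increasing[of 0 n "2::real"] power_int_strict_increasing[of n 0 "2::real"]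
      by (cases n "0::int" rule: linorder_cases) auto
    ultimately show False using pq by fastforce
  qed
qed

section \<open>Local charts and critical points\<close>

lemma continuous_on_torus_char: "continuous_on complex_torus (torus_char p q)"
proof -
  have "torus_char p q = (\<lambda>x. fst x powi q * snd x powi (- p))"
    by (auto simp: torus_char_def)
  then show ?thesis
    by (simp add: complex_torus_def) (intro continuous_intros; auto)
qed

lemma open_complex_torus: "open complex_torus"
proof -
  have "complex_torus = (- {0}) \<times> (- {0})"
    by (auto simp: complex_torus_def)
  then show ?thesis by (metis open_Compl open_Times closed_singleton)
qed

text \<open>In logarithmic coordinates around the base point the level set becomes the complex line
  spanned by (p, q), on which Bezout coefficients give a linear coordinate.\<close>

lemma curve_chart_torus_char:
  assumes bez: "r * p + s * q = 1" and fin: "finite A"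
    and C: "C = {x \<in> complex_torus. torus_char p q x \<in> A}" and x0: "(z0, w0) \<in> C"
  obtains U where "0 \<in> U"
    "curve_chart C U (\<lambda>t. (z0 * exp (of_int p * t), w0 * exp (of_int q * t)))"
proof -
  define \<phi> where "\<phi> = (\<lambda>t. (z0 * exp (of_int p * t), w0 * exp (of_int q * t)))"
  \<comment> \<open>Logarithms \<open>\<alpha>\<close>, \<open>\<beta>\<close> of size below \<open>d\<close> satisfy \<open>|q \<alpha> - p \<beta>| < pi\<close>, so \<open>exp (q \<alpha> - p \<beta>) = 1\<close> forces
    \<open>q \<alpha> = p \<beta>\<close>.\<close>
  define d where "d = pi / (1 + \<bar>p\<bar> + \<bar>q\<bar>)"
  define U where "U = {t. cmod (of_int p * t) < d \<and> cmod (of_int q * t) < d}"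
  define T where "T = {x. fst x / z0 \<in> - \<real>\<^sub>\<le>\<^sub>0} \<inter> {x. snd x / w0 \<in> - \<real>\<^sub>\<le>\<^sub>0}"
  define lg where "lg = (\<lambda>x. (Ln (fst x / z0), Ln (snd x / w0)))"
  \<comment> \<open>On logarithms \<open>(p t, q t)\<close> this returns
    \<open>(r p + s q) t = t\<close>.\<close>
  define \<psi> where "\<psi> = (\<lambda>x. of_int r * fst (lg x) + of_int s * snd (lg x))"
  define c where "c = torus_char p q (z0, w0)"
  \<comment> \<open>\<open>T\<close> keeps the coordinate ratios off the branch cut of
    \<open>Ln\<close>, the bound \<open>d\<close> on the logarithms matches \<open>U\<close>, and
    the last factor removes the finitely many other level sets. Then \<open>\<phi>\<close> maps
    \<open>U\<close> onto exactly \<open>C \<inter> V\<close>, which is open in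
    \<open>C\<close>.\<close>
  define V where "V = (T \<inter> lg -` (ball 0 d \<times> ball 0 d)) \<inter> (complex_torus \<inter> torus_char p q -` (- (A - {c})))"
  have nz: "z0 \<noteq> 0" "w0 \<noteq> 0" and c: "c \<in> A"
    using x0 by (auto simp: C c_def complex_torus_def)
  have d: "0 < d" "d \<le> pi" "(\<bar>p\<bar> + \<bar>q\<bar>) * d < pi"
    by (auto simp: d_def field_simps add_nonneg_pos)
  have bezC: "of_int r * of_int p + of_int s * of_int q = (1::complex)"
    using bez by (metis of_int_1 of_int_add of_int_mult)
  have U: "open U" "0 \<in> U"
    using d(1) unfolding U_def by (auto intro!: open_Collect_conj open_Collect_less continuous_intros)
  have T: "open T"
    unfolding T_def
    by (intro open_Int open_vimage[unfolded vimage_def] continuous_intros) (use nz in auto)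
  have lg: "continuous_on T lg"
    unfolding lg_def T_def by (intro continuous_intros) (use nz in auto)
  have V: "open V"
    unfolding V_def
    using T lg fin by (intro open_Int continuous_open_preimage open_complex_torus
        continuous_on_torus_char open_Times open_ball open_Compl finite_imp_closed finite_Diff)
  have exp_T: "exp u \<notin> \<real>\<^sub>\<le>\<^sub>0" "Ln (exp u) = u" if "cmod u < d" for u
  proof -
    have "\<bar>Im u\<bar> < pi"
      using that d(2) abs_Im_le_cmod[of u] by linarith
    then show "Ln (exp u) = u" by simp
    then have "Im (Ln (exp u)) \<noteq> pi" using \<open>\<bar>Im u\<bar> < pi\<close> by auto
    then show "exp u \<notin> \<real>\<^sub>\<le>\<^sub>0"
      using Im_Ln_eq_pi[of "exp u"] exp_not_eq_zero[of u]
      by (metis complex_nonpos_Reals_iff complex_eq_iff order_le_less zero_complex.simps)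
  qed
  have char_\<phi>: "torus_char p q (\<phi> t) = c" for t
    using nz by (simp add: \<phi>_def c_def torus_char_def power_int_mult_distrib exp_power_int
        mult_ac power_int_minus flip: exp_add)
  have lg_\<phi>: "lg (\<phi> t) = (of_int p * t, of_int q * t)" if "t \<in> U" for t
    using that nz by (simp add: lg_def \<phi>_def U_def exp_T)
  have \<phi>U: "\<phi> t \<in> C \<inter> V" if "t \<in> U" for t
    using that nz c char_\<phi>[of t] lg_\<phi>[OF that]
    by (auto simp: C V_def T_def U_def \<phi>_def complex_torus_def exp_T)
  have \<psi>\<phi>: "\<psi> (\<phi> t) = t" if "t \<in> U" for t
  proof -
    have "\<psi> (\<phi> t) = (of_int r * of_int p + of_int s * of_int q) * t"
      by (simp add: \<psi>_def lg_\<phi>[OF that] algebra_simps)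
    then show ?thesis by (simp add: bezC)
  qed
  have \<psi>V: "\<psi> x \<in> U" "\<phi> (\<psi> x) = x" if x: "x \<in> C \<inter> V" for x
  proof -
    obtain \<alpha> \<beta> where \<alpha>\<beta>: "lg x = (\<alpha>, \<beta>)" by fastforce
    have small: "cmod \<alpha> < d" "cmod \<beta> < d"
      using x \<alpha>\<beta> by (auto simp: V_def)
    have ex: "exp \<alpha> = fst x / z0" "exp \<beta> = snd x / w0"
      using x nz \<alpha>\<beta> by (auto simp: V_def complex_torus_def lg_def)
    have "torus_char p q (fst x, snd x) = torus_char p q (z0, w0)"
      using x by (auto simp: V_def C c_def)
    then have "exp \<alpha> powi q = exp \<beta> powi p"
      unfolding ex using x nz by (subst (asm) torus_char_eq_iff) (auto simp: C complex_torus_def)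
    then have eq: "exp (of_int q * \<alpha> - of_int p * \<beta>) = 1"
      by (simp add: exp_power_int exp_diff)
    have "cmod (of_int q * \<alpha> - of_int p * \<beta>) \<le> \<bar>q\<bar> * cmod \<alpha> + \<bar>p\<bar> * cmod \<beta>"
      by (rule order_trans[OF norm_triangle_ineq4]) (simp add: norm_mult)
    also have "\<dots> \<le> \<bar>q\<bar> * d + \<bar>p\<bar> * d"
      using small by (intro add_mono mult_left_mono) auto
    also have "\<dots> < pi"
      using d(3) by (simp add: algebra_simps)
    finally have "of_int q * \<alpha> - of_int p * \<beta> = 0"
      using eq by (intro exp_complex_eqI[of _ 0]) 
        (use abs_Im_le_cmod[of "of_int q * \<alpha> - of_int p * \<beta>"] in auto)
    then have qp: "of_int q * \<alpha> = of_int p * \<beta>" by simp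
    have \<psi>x: "\<psi> x = of_int r * \<alpha> + of_int s * \<beta>"
      by (simp add: \<psi>_def \<alpha>\<beta>)
    \<comment> \<open>With \<open>q \<alpha> = p \<beta>\<close> the Bezout identity shows that
      \<open>\<psi> x\<close> solves \<open>p t = \<alpha>\<close> and \<open>q t = \<beta>\<close>
      simultaneously.\<close>
    have "of_int p * \<psi> x = of_int r * of_int p * \<alpha> + of_int s * (of_int p * \<beta>)"
      by (simp add: \<psi>x algebra_simps)
    also have "\<dots> = (of_int r * of_int p + of_int s * of_int q) * \<alpha>"
      by (simp add: algebra_simps qp[symmetric, simplified mult.commute])
    finally have p: "of_int p * \<psi> x = \<alpha>" by (simp add: bezC)
    have "of_int q * \<psi> x = of_int r * (of_int q * \<alpha>) + of_int s * of_int q * \<beta>"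
      by (simp add: \<psi>x algebra_simps)
    also have "\<dots> = (of_int r * of_int p + of_int s * of_int q) * \<beta>"
      by (simp add: algebra_simps qp[simplified mult.commute])
    finally have q: "of_int q * \<psi> x = \<beta>" by (simp add: bezC)
    show "\<psi> x \<in> U" using small by (simp add: U_def p q)
    show "\<phi> (\<psi> x) = x" using nz by (simp add: \<phi>_def p q ex)
  qed
  have im: "\<phi> ` U = C \<inter> V"
    using \<phi>U \<psi>V by (metis (no_types, lifting) image_eqI image_subsetI subsetI subset_antisym)
  have "curve_chart C U \<phi>"
    unfolding curve_chart_def
  proof (intro conjI ballI exI)
    show "open U" by (rule U)
    show "(\<lambda>t. fst (\<phi> t)) holomorphic_on U" "(\<lambda>t. snd (\<phi> t)) holomorphic_on U"
      by (auto simp: \<phi>_def intro!: holomorphic_intros)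
    show "openin (top_of_set C) (\<phi> ` U)"
      unfolding im using V by (simp add: openin_open_Int)
    show "homeomorphism U (\<phi> ` U) \<phi> \<psi>"
    proof
      show "continuous_on U \<phi>"
        unfolding \<phi>_def by (intro continuous_intros)
      have "continuous_on (\<phi> ` U) lg"
        by (rule continuous_on_subset[OF lg]) (auto simp: im V_def)
      then show "continuous_on (\<phi> ` U) \<psi>"
        unfolding \<psi>_def by (intro continuous_intros)
    qed (use \<psi>\<phi> in auto)
    fix t assume "t \<in> U"
    have "deriv (\<lambda>t. fst (\<phi> t)) t = z0 * (of_int p * exp (of_int p * t))"
      "deriv (\<lambda>t. snd (\<phi> t)) t = w0 * (of_int q * exp (of_int q * t))"
      by (auto simp: \<phi>_def intro!: DERIV_imp_deriv derivative_eq_intros)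
    \<comment> \<open>Both derivatives vanish only if p = q = 0, which the Bezout identity
      excludes.\<close>
    then show "(deriv (\<lambda>t. fst (\<phi> t)) t, deriv (\<lambda>t. snd (\<phi> t)) t) \<noteq> (0, 0)"
      using nz bez by auto
  qed
  with U(2) show ?thesis
    using that by (simp add: \<phi>_def)
qed

lemma critical_points_subset: "critical_points C \<subseteq> C"
  by (auto simp: critical_points_def curve_chart_def dest!: openin_imp_subset)

lemma critical_points_torus_char:
  assumes "coprime p q" and fin: "finite A"
    and C: "C = {x \<in> complex_torus. torus_char p q x \<in> A}"
  shows "critical_points C = C"
proof (intro equalityI subsetI)
  fix x assume x: "x \<in> C"
  obtain z w where zw: "x = (z, w)" by fastforce
  then have nz: "z \<noteq> 0" "w \<noteq> 0"
    using x by (auto simp: C complex_torus_def)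
  obtain r s where bez: "r * p + s * q = 1"
    using bezout_int[of p q] assms(1) by (auto simp: coprime_iff_gcd_eq_1)
  define \<phi> where "\<phi> = (\<lambda>t. (z * exp (of_int p * t), w * exp (of_int q * t)))"
  obtain U where U: "0 \<in> U" "curve_chart C U \<phi>"
    using curve_chart_torus_char[OF bez fin C] x unfolding zw \<phi>_def by blast
  \<comment> \<open>The velocity of the image under \<open>arg_map\<close> as Im t increases through
    0. Changes of Re t contribute nothing, so the derivative has its range in the real line spanned
    by \<open>y\<close>.\<close>
  define y where "y = (sgn z * (of_int p * \<i>), sgn w * (of_int q * \<i>))"
  define D where "D = (\<lambda>h. Im h *\<^sub>R y)"
  have norm_exp: "u * exp t / of_real (cmod (u * exp t)) = sgn u * cis (Im t)" for u t
    by (simp add: sgn_eq norm_mult exp_eq_polar[of t] field_simps)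
  have "(\<lambda>t. arg_map (\<phi> t)) = (\<lambda>t. (sgn z * cis (of_int p * Im t), sgn w * cis (of_int q * Im t)))"
    by (simp add: \<phi>_def arg_map_def norm_exp fun_eq_iff)
  moreover have "(\<dots> has_derivative D) (at 0)"
    by (auto intro!: derivative_eq_intros simp: D_def y_def fun_eq_iff scaleR_conv_of_real)
  ultimately have "((\<lambda>t. arg_map (\<phi> t)) has_derivative D) (at 0)"
    by simp
  moreover have "dim (range D) < 2"
  proof -
    have "range D \<subseteq> span {y}"
      unfolding D_def by (intro image_subsetI span_mul span_base) simp
    then have "dim (range D) \<le> card {y}"
      by (intro dim_le_card) auto
    then show ?thesis by simp
  qed
  moreover have "\<phi> 0 = x" by (simp add: \<phi>_def zw)
  ultimately show "x \<in> critical_points C"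
    using U unfolding critical_points_def by blast
qed (use critical_points_subset in blast)

section \<open>Critical values and realization of the link\<close>

text \<open>The character is multiplicative and so commutes with \<open>sgn\<close>, which fixes the
  unimodular values in \<open>A\<close>. Conversely, \<open>arg_map\<close> fixes each point of the
  real torus.\<close>

lemma arg_map_image_torus_char:
  assumes A: "\<And>c. c \<in> A \<Longrightarrow> cmod c = 1"
  shows "arg_map ` {x \<in> complex_torus. torus_char p q x \<in> A} = {x \<in> real_torus. torus_char p q x \<in> A}"
proof (intro equalityI subsetI)
  fix x assume x: "x \<in> {x \<in> real_torus. torus_char p q x \<in> A}"
  then have "arg_map x = x" "x \<in> complex_torus"
    by (auto simp: real_torus_def arg_map_def complex_torus_def)
  then show "x \<in> arg_map ` {x \<in> complex_torus. torus_char p q x \<in> A}"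
    using x by (intro image_eqI[of _ _ x]) auto
next
  fix x assume "x \<in> arg_map ` {x \<in> complex_torus. torus_char p q x \<in> A}"
  then obtain z w where zw: "z \<noteq> 0" "w \<noteq> 0" "torus_char p q (z, w) \<in> A"
    and x: "x = (sgn z, sgn w)"
    by (auto simp: complex_torus_def arg_map_def sgn_eq)
  have "torus_char p q x = sgn (torus_char p q (z, w))"
    by (simp add: x torus_char_def sgn_mult sgn_eq norm_power_int norm_mult power_int_divide_distrib)
  also have "\<dots> = torus_char p q (z, w)"
    using A[OF zw(3)] by (simp add: sgn_eq)
  finally show "x \<in> {x \<in> real_torus. torus_char p q x \<in> A}"
    using zw by (auto simp: x real_torus_def norm_sgn)
qed

text \<open>Being compact, connected and nonempty, the circles are precisely the components of their
  union, so passing to the one-dimensional part discards nothing.\<close>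

lemma one_dimensional_part_Union:
  fixes \<F> :: "'a::t2_space set set"
  assumes "finite \<F>" "pairwise disjnt \<F>" "\<And>S. S \<in> \<F> \<Longrightarrow> S homeomorphic sphere (0::complex) 1"
  shows "one_dimensional_part (\<Union>\<F>) = \<Union>\<F>"
proof -
  have "closed S \<and> connected S \<and> S \<noteq> {}" if "S \<in> \<F>" for S
    using assms(3)[OF that] homeomorphic_compactness[of S "sphere (0::complex) 1"]
      homeomorphic_connectedness[of S "sphere (0::complex) 1"]
      homeomorphic_empty(1)[of "sphere (0::complex) 1"] connected_sphere[of "0::complex" 1]
      compact_imp_closed[of S]
    by auto
  then have "components (\<Union>\<F>) = \<F>"
    using assms(1,2) by (intro components_Union_finite)
  moreover have "one_dimensional S" if "S \<in> \<F>" for S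
    using assms(3)[OF that] one_dimensional_circle by (rule one_dimensional_homeomorphic)
  ultimately show ?thesis
    by (auto simp: one_dimensional_part_def)
qed

lemma realize_parallel_curves:
  assumes K: "parallel_curves p q K" "K \<noteq> {}"
  shows "\<exists>C. plane_curve C \<and> one_dimensional_part (critical_values C) = K"
proof -
  define g where "g = gcd p q"
  define p' q' where "p' = p div g" and "q' = q div g"
  from K(1) obtain a b :: "nat \<Rightarrow> complex" where
    ab: "\<And>j. j < nat g \<Longrightarrow> (a j, b j) \<in> real_torus" and
    disj: "\<And>i j. i < nat g \<Longrightarrow> j < nat g \<Longrightarrow> i \<noteq> j \<Longrightarrow>
      winding_curve p' q' (a i) (b i) \<inter> winding_curve p' q' (a j) (b j) = {}" and
    K_eq: "K = (\<Union>j < nat g. winding_curve p' q' (a j) (b j))"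
    unfolding parallel_curves_def g_def[symmetric] p'_def[symmetric] q'_def[symmetric] by metis
  \<comment> \<open>For g = 0 the index set, and with it \<open>K\<close>, would be empty.\<close>
  have "g \<noteq> 0" using K(2) K_eq by auto
  then have cop: "coprime p' q'"
    unfolding g_def p'_def q'_def by (intro div_gcd_coprime) auto
  \<comment> \<open>One character value per curve; all the parallel curves have the same type, so a
    single character serves for all of them.\<close>
  define A where "A = (\<lambda>j. torus_char p' q' (a j, b j)) ` {..<nat g}"
  define C where "C = {x \<in> complex_torus. torus_char p' q' x \<in> A}"
  have fin: "finite A" by (simp add: A_def)
  have A1: "cmod c = 1" if "c \<in> A" for c
    using that ab by (auto simp: A_def torus_char_def norm_mult norm_power_int real_torus_def)
  have "K = {x \<in> real_torus. torus_char p' q' x \<in> A}"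
    using ab by (auto simp: K_eq A_def winding_curve_eq_level_set[OF cop])
  also have "\<dots> = critical_values C"
    unfolding critical_values_def C_def critical_points_torus_char[OF cop fin refl]
    using A1 by (simp add: arg_map_image_torus_char)
  finally have crit: "critical_values C = K" ..
  have "C \<noteq> {}"
    using crit K(2) critical_points_subset[of C] by (auto simp: critical_values_def)
  have "plane_curve C"
    unfolding C_def
  proof (rule plane_curve_torus_char[OF fin A1])
    show "(p', q') \<noteq> (0, 0)" using cop by auto
    show "{x \<in> complex_torus. torus_char p' q' x \<in> A} \<noteq> {}" using \<open>C \<noteq> {}\<close> by (simp add: C_def)
  qed
  moreover have "one_dimensional_part K = K"
    unfolding K_eq
  proof (rule one_dimensional_part_Union)
    show "pairwise disjnt ((\<lambda>j. winding_curve p' q' (a j) (b j)) ` {..<nat g})"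
      using disj by (auto simp: pairwise_def disjnt_def)
  qed (use ab winding_curve_homeomorphic_circle[OF cop] in auto)
  ultimately show ?thesis using crit by auto
qed

theorem corollary4p7:
  fixes L :: "(real^3) set"
  assumes "torus_link L"
  shows "\<exists>C :: (complex \<times> complex) set. plane_curve C \<and>
           link (std_torus ` one_dimensional_part (critical_values C)) \<and>
           link_equivalent (std_torus ` one_dimensional_part (critical_values C)) L"
proof -
  obtain e p q K where L: "link L" "L = e ` K" and e: "unknotted_torus e" and K: "parallel_curves p q K"
    using assms by (auto simp: torus_link_def)
  obtain H where H: "ambient_isotopy H" and eH: "\<And>x. x \<in> real_torus \<Longrightarrow> e x = H 1 (std_torus x)"
    using e by (auto simp: unknotted_torus_def)
  \<comment> \<open>\<open>e\<close> is only known to agree with \<open>H 1\<close> after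
    \<open>std_torus\<close> on the real torus.\<close>
  have "K \<subseteq> real_torus"
    using K by (fastforce simp: parallel_curves_def winding_curve_def real_torus_def norm_mult)
  then have LK: "H 1 ` std_torus ` K = L"
    unfolding L image_image using eH by (intro image_cong) auto
  \<comment> \<open>A link has at least one circle; hence \<open>K\<close> is nonempty, which rules
    out p = q = 0.\<close>
  have "L \<noteq> {}"
    using L(1) by (auto simp: link_def homeomorphic_empty lessThan_empty_iff)
  then obtain C where C: "plane_curve C" "one_dimensional_part (critical_values C) = K"
    using realize_parallel_curves[OF K] L(2) by auto
  have "(1::real) \<in> {0..1}" by simp
  then obtain G where "homeomorphism UNIV UNIV (H 1) G"
    using H unfolding ambient_isotopy_def by blast
  \<comment> \<open>The final map of the isotopy restricts to a homeomorphism onto \<open>L\<close>,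
    so being a link passes back from \<open>L\<close> to the realized set.\<close>
  then have "homeomorphism (std_torus ` K) L (H 1) G"
    by (rule homeomorphism_of_subsets) (use LK in auto)
  then have "link (std_torus ` K)"
    using L(1) by (meson homeomorphic_def homeomorphic_trans link_def)
  moreover have "link_equivalent (std_torus ` K) L"
    using H LK by (auto simp: link_equivalent_def)
  ultimately show ?thesis using C by auto
qed

end
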